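(* Let $\mathcal{X}$ be a compact metric space, $\alpha\in(0,1]$, $x^{(1)},\ldots,x^{(M)}\in\mathcal{X}$, and $\varepsilon_1,\ldots,\varepsilon_M\ge0$. Let $Z$ be a Banach lattice and let $\Gamma:B(\mathcal{X})\to Z$ be a linear map that is monotone, i.e., $f\ge f'$ implies $\Gamma(f)\ge\Gamma(f')$. For $\Delta:\mathbb{R}^M\to Z$, put $$\mathrm{gwce}_{\boldsymbol{\varepsilon}}(\Delta):=\sup\big\{\|\Gamma(f)-\Delta(\mathbf{y})\|_Z:\ f\in\mathcal{H}_\alpha,\ y_m=f(x^{(m)})+e_m,\ |e_m|\le\varepsilon_m,\ m=1,\ldots,M\big\}.$$ Then the minimal global worst-case error is $$\inf_{\Delta:\mathbb{R}^M\to Z}\mathrm{gwce}_{\boldsymbol{\varepsilon}}(\Delta)=\|\Gamma(u_{\mathbf{0},\boldsymbol{\varepsilon}})\|_Z,\qquad\text{where } u_{\mathbf{0},\boldsymbol{\varepsilon}}(x)=\min_{1\le m\le M}\big(\varepsilon_m+\mathrm{dist}(x,x^{(m)})^\alpha\big).$$ Furthermore, the infimum is achieved for the recovery map $\Gamma\circ\Delta^{\mathrm{glo}}:\mathbb{R}^M\to Z$, where $$\Delta^{\mathrm{glo}}:\mathbf{y}\in\mathbb{R}^M\mapsto\sum_{m=1}^M y_m\,\mathbf{1}_{V_{\boldsymbol{\varepsilon},m}}\in B(\mathcal{X}),$$ with $V_{\boldsymbol{\varepsilon},1},\ldots,V_{\boldsymbol{\varepsilon},M}\subseteq\mathcal{X}$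 the Voronoi-type cells defined by $$V_{\boldsymbol{\varepsilon},m}:=\big\{x\in\mathcal{X}:\ \varepsilon_m+\mathrm{dist}(x,x^{(m)})^\alpha\le\varepsilon_n+\mathrm{dist}(x,x^{(n)})^\alpha\ \text{for all } n=1,\ldots,M\big\}.$$
   Context: $\mathcal{H}_\alpha:=\{f:\mathcal{X}\to\mathbb{R} : |f(x)-f(x')|\le\mathrm{dist}(x,x')^\alpha \text{ for all } x,x'\in\mathcal{X}\}$, where $\mathrm{dist}$ is the metric of $\mathcal{X}$. $B(\mathcal{X})$ is the space of bounded real-valued functions on $\mathcal{X}$ with the pointwise order. A Banach lattice has the usual order and absolute value $|z|=\max\{-z,z\}$, and its norm is monotone: $|z|\ge|z'|$ implies $\|z\|_Z\ge\|z'\|_Z$. $\mathbf{1}_V$ is the indicator function of a set $V$, equal to $1$ on $V$ and $0$ off $V$.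
   Formalization: The cells V_{ε,m} may overlap at ties, where the stated sum adds several data values and attainment can fail; attainment is proved instead for every family of pairwise disjoint subsets of the cells that covers the space. *)

theory Defs
  imports "HOL-Analysis.Analysis" "HOL-Library.Lattice_Algebras"
begin

text \<open>The parent class \<open>lattice_ab_group_add_abs\<close> contributes \<open>\<bar>z\<bar> = sup z (- z)\<close>.\<close>

class banach_lattice = banach + ordered_real_vector + lattice_ab_group_add_abs +
  assumes norm_mono_abs: "\<bar>x\<bar> \<le> \<bar>y\<bar> \<Longrightarrow> norm x \<le> norm y"

instance real :: banach_lattice
  by standard simp

definition holder_class :: "real \<Rightarrow> ('a::metric_space \<Rightarrow> real) set" where
  "holder_class \<alpha> = {f. \<forall>s t. \<bar>f s - f t\<bar> \<le> dist s t powr \<alpha>}"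

text \<open>A map on \<open>B(\<X>)\<close> is represented by a total function on \<open>'a \<Rightarrow> real\<close>, all of whose
  properties are required only on the following set; its values elsewhere are arbitrary.\<close>

definition bounded_functions :: "('a \<Rightarrow> real) set" where
  "bounded_functions = {f. bounded (range f)}"

definition linear_on_bounded :: "(('a \<Rightarrow> real) \<Rightarrow> 'z::real_vector) \<Rightarrow> bool" where
  "linear_on_bounded \<Gamma> \<longleftrightarrow>
     (\<forall>f\<in>bounded_functions. \<forall>g\<in>bounded_functions. \<Gamma> (\<lambda>t. f t + g t) = \<Gamma> f + \<Gamma> g) \<and>
     (\<forall>c. \<forall>f\<in>bounded_functions. \<Gamma> (\<lambda>t. c * f t) = c *\<^sub>R \<Gamma> f)"

text \<open>The data sites are a family \<open>x\<close> over a finite index type \<open>'m\<close>, which is automatically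
  nonempty. The supremum is extended-real-valued, as a recovery map may have infinite error.\<close>

definition gwce ::
  "(('a::metric_space \<Rightarrow> real) \<Rightarrow> 'z::real_normed_vector) \<Rightarrow> real \<Rightarrow> ('m::finite \<Rightarrow> 'a) \<Rightarrow> real^'m
     \<Rightarrow> (real^'m \<Rightarrow> 'z) \<Rightarrow> ereal" where
  "gwce \<Gamma> \<alpha> x \<epsilon> \<Delta> =
     Sup {ereal (norm (\<Gamma> f - \<Delta> y)) | f y e.
            f \<in> holder_class \<alpha> \<and> (\<forall>m. y $ m = f (x m) + e $ m \<and> \<bar>e $ m\<bar> \<le> \<epsilon> $ m)}"

definition u_zero :: "real \<Rightarrow> ('m::finite \<Rightarrow> 'a::metric_space) \<Rightarrow> real^'m \<Rightarrow> 'a \<Rightarrow> real" where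
  "u_zero \<alpha> x \<epsilon> t = (MIN m. \<epsilon> $ m + dist t (x m) powr \<alpha>)"

definition voronoi_cell ::
  "real \<Rightarrow> ('m::finite \<Rightarrow> 'a::metric_space) \<Rightarrow> real^'m \<Rightarrow> 'm \<Rightarrow> 'a set" where
  "voronoi_cell \<alpha> x \<epsilon> m =
     {t. \<forall>n. \<epsilon> $ m + dist t (x m) powr \<alpha> \<le> \<epsilon> $ n + dist t (x n) powr \<alpha>}"

text \<open>The cells cover the space but overlap at ties, where \<open>\<Sum>m. y\<^sub>m \<one>\<^bsub>V m\<^esub>\<close> would add up several
  data values: with one point \<open>t\<close>, two coinciding sites, \<open>\<epsilon> = 0\<close> and \<open>\<Gamma> f = f t\<close>, constant
  functions already make the error of that map infinite, while the minimal error is \<open>0\<close>.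
  Hence every point lying in several cells is assigned to one of them, in an arbitrary way. If the
  cells happen to be disjoint, they themselves are the only such assignment.\<close>

definition voronoi_partition ::
  "real \<Rightarrow> ('m::finite \<Rightarrow> 'a::metric_space) \<Rightarrow> real^'m \<Rightarrow> ('m \<Rightarrow> 'a set) \<Rightarrow> bool" where
  "voronoi_partition \<alpha> x \<epsilon> V \<longleftrightarrow>
     (\<forall>m. V m \<subseteq> voronoi_cell \<alpha> x \<epsilon> m) \<and> disjoint_family V \<and> (\<Union>m. V m) = UNIV"

lemma voronoi_cells_cover:
  fixes x :: "'m::finite \<Rightarrow> 'a::metric_space"
  shows "\<exists>m. t \<in> voronoi_cell \<alpha> x \<epsilon> m"
proof -
  obtain m where "is_arg_min (\<lambda>m. \<epsilon> $ m + dist t (x m) powr \<alpha>) (\<lambda>m. m \<in> UNIV) m"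
    using ex_is_arg_min_if_finite[of UNIV "\<lambda>m. \<epsilon> $ m + dist t (x m) powr \<alpha>"] by auto
  then have "t \<in> voronoi_cell \<alpha> x \<epsilon> m"
    by (auto simp: voronoi_cell_def is_arg_min_linorder)
  then show ?thesis ..
qed

lemma voronoi_partition_exists:
  fixes x :: "'m::finite \<Rightarrow> 'a::metric_space"
  shows "\<exists>V. voronoi_partition \<alpha> x \<epsilon> V"
proof -
  obtain c where c: "\<And>t. t \<in> voronoi_cell \<alpha> x \<epsilon> (c t)"
    using choice[of "\<lambda>t m. t \<in> voronoi_cell \<alpha> x \<epsilon> m"] voronoi_cells_cover by blast
  have "voronoi_partition \<alpha> x \<epsilon> (\<lambda>m. {t. c t = m})"
    using c by (auto simp: voronoi_partition_def disjoint_family_on_def)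
  then show ?thesis by blast
qed

lemma voronoi_partition_disjoint_cells:
  fixes x :: "'m::finite \<Rightarrow> 'a::metric_space"
  assumes "disjoint_family (voronoi_cell \<alpha> x \<epsilon>)"
  shows "voronoi_partition \<alpha> x \<epsilon> V \<longleftrightarrow> V = voronoi_cell \<alpha> x \<epsilon>"
proof
  assume V: "voronoi_partition \<alpha> x \<epsilon> V"
  have "t \<in> V m" if t: "t \<in> voronoi_cell \<alpha> x \<epsilon> m" for t m
  proof -
    obtain n where n: "t \<in> V n" using V unfolding voronoi_partition_def by blast
    then have "t \<in> voronoi_cell \<alpha> x \<epsilon> n" using V unfolding voronoi_partition_def by blast
    then have "n = m" using t assms unfolding disjoint_family_on_def by blast
    then show ?thesis using n by simp
  qed
  then show "V = voronoi_cell \<alpha> x \<epsilon>"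
    using V unfolding voronoi_partition_def by (intro ext equalityI) auto
next
  assume "V = voronoi_cell \<alpha> x \<epsilon>"
  moreover have "(\<Union>m. voronoi_cell \<alpha> x \<epsilon> m) = UNIV"
    by (simp add: set_eq_iff voronoi_cells_cover)
  ultimately show "voronoi_partition \<alpha> x \<epsilon> V"
    using assms by (simp add: voronoi_partition_def)
qed

definition delta_glo :: "('m::finite \<Rightarrow> 'a set) \<Rightarrow> real^'m \<Rightarrow> 'a \<Rightarrow> real" where
  "delta_glo V y = (\<lambda>t. \<Sum>m\<in>UNIV. y $ m * indicator (V m) t)"

end

theory Submission
  imports Defs
begin

text \<open>Both \<open>u = u_zero\<close> and \<open>-u\<close> lie in the Hoelder class and are compatible with the data
  \<open>0\<close>, so the errors of any recovery map at these two functions average to at least \<open>\<parallel>\<Gamma> u\<parallel>\<close>.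
  Conversely, the cells are chosen so that \<open>\<bar>f - \<Delta> y\<bar> \<le> u\<close> pointwise for the piecewise constant map
  \<open>\<Delta>\<close>; monotonicity of \<open>\<Gamma>\<close> and of the lattice norm turns this into an error of at most
  \<open>\<parallel>\<Gamma> u\<parallel>\<close>.\<close>

text \<open>Dividing by \<open>a + b\<close> turns the summands into two numbers of [0,1] with sum
  1, and on [0,1] raising to a power \<open>p \<le> 1\<close> can only increase a number.\<close>

lemma powr_add_le_add_powr:
  fixes a b p :: real
  assumes "0 \<le> a" "0 \<le> b" "0 \<le> p" "p \<le> 1"
  shows "(a + b) powr p \<le> a powr p + b powr p"
proof (cases "a + b = 0")
  case True
  then show ?thesis using assms by simp
next
  case False
  define s where "s = a + b"
  have s: "0 < s" using False assms unfolding s_def by linarith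
  have le: "r \<le> r powr p" if "0 \<le> r" "r \<le> 1" for r :: real
    using powr_mono'[of p 1 r] assms that by simp
  have "1 = a / s + b / s"
    using s by (simp add: s_def flip: add_divide_distrib)
  also have "\<dots> \<le> (a / s) powr p + (b / s) powr p"
    using s assms by (intro add_mono le) (auto simp: s_def)
  also have "\<dots> = (a powr p + b powr p) / s powr p"
    using s assms by (simp add: powr_divide add_divide_distrib)
  finally show ?thesis
    using s by (simp add: pos_le_divide_eq flip: s_def)
qed

text \<open>By subadditivity of the power, \<open>dist s t powr \<alpha>\<close> inherits the
  triangle inequality from \<open>dist\<close>; the Hoelder bound is its reverse triangle
  inequality.\<close>

lemma dist_powr_holder:
  assumes "0 \<le> \<alpha>" "\<alpha> \<le> 1"
  shows "(\<lambda>t. dist t z powr \<alpha>) \<in> holder_class \<alpha>"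
proof -
  have le: "dist s z powr \<alpha> \<le> dist s t powr \<alpha> + dist t z powr \<alpha>" for s t
  proof -
    have "dist s z powr \<alpha> \<le> (dist s t + dist t z) powr \<alpha>"
      using assms by (intro powr_mono2 dist_triangle) auto
    also have "\<dots> \<le> dist s t powr \<alpha> + dist t z powr \<alpha>"
      using assms by (intro powr_add_le_add_powr) auto
    finally show ?thesis .
  qed
  have "\<bar>dist s z powr \<alpha> - dist t z powr \<alpha>\<bar> \<le> dist s t powr \<alpha>" for s t
    using le[of s t] le[of t s] by (simp add: abs_le_iff dist_commute)
  then show ?thesis unfolding holder_class_def by blast
qed

lemma u_zero_le: "u_zero \<alpha> x \<epsilon> t \<le> \<epsilon> $ m + dist t (x m) powr \<alpha>"
  unfolding u_zero_def by (intro Min_le) auto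

lemma u_zero_attained:
  obtains m where "u_zero \<alpha> x \<epsilon> t = \<epsilon> $ m + dist t (x m) powr \<alpha>"
proof -
  have "u_zero \<alpha> x \<epsilon> t \<in> range (\<lambda>m. \<epsilon> $ m + dist t (x m) powr \<alpha>)"
    unfolding u_zero_def by (intro Min_in) auto
  then show thesis using that by auto
qed

text \<open>The cell of \<open>m\<close> consists of the points at which the term of index
  \<open>m\<close> attains the minimum.\<close>

lemma u_zero_on_cell:
  assumes "t \<in> voronoi_cell \<alpha> x \<epsilon> m"
  shows "u_zero \<alpha> x \<epsilon> t = \<epsilon> $ m + dist t (x m) powr \<alpha>"
proof (rule antisym[OF u_zero_le])
  obtain n where "u_zero \<alpha> x \<epsilon> t = \<epsilon> $ n + dist t (x n) powr \<alpha>"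
    by (rule u_zero_attained)
  then show "\<epsilon> $ m + dist t (x m) powr \<alpha> \<le> u_zero \<alpha> x \<epsilon> t"
    using assms unfolding voronoi_cell_def by simp
qed

lemma u_zero_nonneg:
  assumes "\<And>m. 0 \<le> \<epsilon> $ m"
  shows "0 \<le> u_zero \<alpha> x \<epsilon> t"
  by (rule u_zero_attained[of \<alpha> x \<epsilon> t]) (use assms in simp)

lemma u_zero_holder:
  assumes "0 \<le> \<alpha>" "\<alpha> \<le> 1"
  shows "u_zero \<alpha> x \<epsilon> \<in> holder_class \<alpha>"
proof -
  \<comment> \<open>The index that is minimal at \<open>t\<close> is used at \<open>s\<close> as
    well: there it gives an upper bound for the minimum, and a single term varies by at most
    \<open>dist s t powr \<alpha>\<close>.\<close>
  have le: "u_zero \<alpha> x \<epsilon> s \<le> u_zero \<alpha> x \<epsilon> t + dist s t powr \<alpha>" for s t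
  proof -
    obtain m where m: "u_zero \<alpha> x \<epsilon> t = \<epsilon> $ m + dist t (x m) powr \<alpha>"
      by (rule u_zero_attained)
    have "\<bar>dist s (x m) powr \<alpha> - dist t (x m) powr \<alpha>\<bar> \<le> dist s t powr \<alpha>"
      using dist_powr_holder[OF assms, of "x m"] unfolding holder_class_def by blast
    then show ?thesis using u_zero_le[of \<alpha> x \<epsilon> s m] m by linarith
  qed
  have "\<bar>u_zero \<alpha> x \<epsilon> s - u_zero \<alpha> x \<epsilon> t\<bar> \<le> dist s t powr \<alpha>" for s t
    using le[of s t] le[of t s] by (simp add: abs_le_iff dist_commute)
  then show ?thesis unfolding holder_class_def by blast
qed

text \<open>A function of the class varies by at most a power of the diameter. This brings it into
  the domain on which linearity and monotonicity of \<open>\<Gamma>\<close> are available.\<close>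

lemma holder_class_bounded:
  assumes "bounded (UNIV :: 'a::metric_space set)" "0 \<le> \<alpha>" and f: "f \<in> holder_class \<alpha>"
  shows "(f :: 'a \<Rightarrow> real) \<in> bounded_functions"
proof -
  fix t\<^sub>0 :: 'a
  obtain r where r: "\<And>t. dist t\<^sub>0 t \<le> r"
    using assms(1) bounded_any_center[of UNIV t\<^sub>0] by auto
  have "dist (f t\<^sub>0) (f t) \<le> r powr \<alpha>" for t
  proof -
    have "dist (f t\<^sub>0) (f t) \<le> dist t\<^sub>0 t powr \<alpha>"
      using f unfolding holder_class_def by (simp add: dist_real_def)
    also have "\<dots> \<le> r powr \<alpha>" using assms r by (intro powr_mono2) auto
    finally show ?thesis .
  qed
  then show ?thesis unfolding bounded_functions_def bounded_def by blast
qed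

lemma bounded_functions_scale:
  "f \<in> bounded_functions \<Longrightarrow> (\<lambda>t. c * f t) \<in> bounded_functions"
  unfolding bounded_functions_def
  using bounded_scaling[of "range f" c] by (simp add: image_image)

lemma bounded_functions_add:
  "f \<in> bounded_functions \<Longrightarrow> g \<in> bounded_functions \<Longrightarrow> (\<lambda>t. f t + g t) \<in> bounded_functions"
  unfolding bounded_functions_def by (simp add: bounded_plus_comp)

lemma linear_on_bounded_uminus:
  assumes "linear_on_bounded \<Gamma>" "f \<in> bounded_functions"
  shows "\<Gamma> (\<lambda>t. - f t) = - \<Gamma> f"
proof -
  have "\<Gamma> (\<lambda>t. (-1) * f t) = (-1) *\<^sub>R \<Gamma> f"
    using assms unfolding linear_on_bounded_def by blast
  then show ?thesis by simp
qed

lemma linear_on_bounded_diff: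
  assumes "linear_on_bounded \<Gamma>" "f \<in> bounded_functions" "g \<in> bounded_functions"
  shows "\<Gamma> (\<lambda>t. f t - g t) = \<Gamma> f - \<Gamma> g"
proof -
  have "\<Gamma> (\<lambda>t. f t + - g t) = \<Gamma> f + \<Gamma> (\<lambda>t. - g t)"
    using assms bounded_functions_scale[of g "-1"] unfolding linear_on_bounded_def by auto
  then show ?thesis by (simp add: linear_on_bounded_uminus[OF assms(1,3)])
qed

text \<open>Both \<open>h\<close> and \<open>-h\<close> lie below \<open>u\<close>, so
  \<open>\<Gamma> h\<close> and its negative lie below \<open>\<Gamma> u\<close>, and hence so does
  their supremum, which is the absolute value of \<open>\<Gamma> h\<close>.\<close>

lemma norm_linear_mono_le:
  fixes \<Gamma> :: "('a \<Rightarrow> real) \<Rightarrow> 'z::banach_lattice"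
  assumes \<Gamma>: "linear_on_bounded \<Gamma>" "mono_on bounded_functions \<Gamma>"
    and h: "h \<in> bounded_functions" and u: "u \<in> bounded_functions"
    and le: "\<And>t. \<bar>h t\<bar> \<le> u t"
  shows "norm (\<Gamma> h) \<le> norm (\<Gamma> u)"
proof (rule norm_mono_abs)
  have nh: "(\<lambda>t. - h t) \<in> bounded_functions"
    using bounded_functions_scale[OF h, of "-1"] by simp
  have "\<Gamma> h \<le> \<Gamma> u"
    using le by (intro mono_onD[OF \<Gamma>(2) h u]) (auto simp: le_fun_def abs_le_iff)
  moreover have "\<Gamma> (\<lambda>t. - h t) \<le> \<Gamma> u"
    using le by (intro mono_onD[OF \<Gamma>(2) nh u]) (auto simp: le_fun_def abs_le_iff)
  ultimately have "\<bar>\<Gamma> h\<bar> \<le> \<Gamma> u"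
    by (simp add: abs_lattice linear_on_bounded_uminus[OF \<Gamma>(1) h])
  also have "\<Gamma> u \<le> \<bar>\<Gamma> u\<bar>" by (simp add: abs_lattice)
  finally show "\<bar>\<Gamma> h\<bar> \<le> \<bar>\<Gamma> u\<bar>" .
qed

text \<open>Disjointness leaves only one nonzero term in the sum, so no data values are added up at
  ties.\<close>

lemma delta_glo_eq:
  assumes "disjoint_family V" "t \<in> V m"
  shows "delta_glo V y t = y $ m"
proof -
  have "delta_glo V y t = (\<Sum>n\<in>UNIV. if n = m then y $ n else 0)"
    unfolding delta_glo_def using assms
    by (intro sum.cong) (auto simp: indicator_def disjoint_family_on_def)
  then show ?thesis by simp
qed

lemma delta_glo_bounded: "delta_glo V y \<in> bounded_functions"
proof -
  have "norm (delta_glo V y t) \<le> (\<Sum>m\<in>UNIV. \<bar>y $ m\<bar>)" for t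
    unfolding delta_glo_def real_norm_def
    by (rule sum_abs[THEN order_trans]) (auto intro!: sum_mono simp: indicator_def)
  then show ?thesis unfolding bounded_functions_def bounded_iff by blast
qed

lemma gwce_ge:
  fixes x :: "'m::finite \<Rightarrow> 'a::metric_space"
  assumes "bounded (UNIV :: 'a set)" "0 \<le> \<alpha>" "\<alpha> \<le> 1" "\<And>m. 0 \<le> \<epsilon> $ m"
    and \<Gamma>: "linear_on_bounded \<Gamma>"
  shows "ereal (norm (\<Gamma> (u_zero \<alpha> x \<epsilon>))) \<le> gwce \<Gamma> \<alpha> x \<epsilon> \<Delta>"
proof -
  let ?u = "u_zero \<alpha> x \<epsilon>"
  have u: "?u \<in> holder_class \<alpha>" using assms by (intro u_zero_holder)
  then have nu: "(\<lambda>t. - ?u t) \<in> holder_class \<alpha>"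
    unfolding holder_class_def by (simp add: abs_minus_commute)
  \<comment> \<open>At its own site, the term of index \<open>m\<close> reduces to
    \<open>\<epsilon> $ m\<close>, because \<open>0 powr \<alpha> = 0\<close>.\<close>
  have site: "\<bar>?u (x m)\<bar> \<le> \<epsilon> $ m" for m
    using u_zero_nonneg[of \<epsilon> \<alpha> x "x m"] u_zero_le[of \<alpha> x \<epsilon> "x m" m] assms by simp
  \<comment> \<open>The noise \<open>- f (x m)\<close> is admissible and cancels the values of
    \<open>f\<close> at the sites, so the observed data are 0.\<close>
  have err: "ereal (norm (\<Gamma> f - \<Delta> 0)) \<le> gwce \<Gamma> \<alpha> x \<epsilon> \<Delta>"
    if "f \<in> holder_class \<alpha>" "\<And>m. \<bar>f (x m)\<bar> \<le> \<epsilon> $ m" for f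
    unfolding gwce_def
    by (intro Sup_upper CollectI exI[of _ f] exI[of _ 0] exI[of _ "\<chi> m. - f (x m)"])
      (use that in simp)
  have "\<Gamma> (\<lambda>t. - ?u t) = - \<Gamma> ?u"
    using assms u by (intro linear_on_bounded_uminus[OF \<Gamma>] holder_class_bounded)
  \<comment> \<open>The common output \<open>\<Delta> 0\<close> drops out of the difference, so the
    bound holds whatever its value.\<close>
  moreover have "2 * norm (\<Gamma> ?u) = norm ((\<Gamma> ?u - \<Delta> 0) - (- \<Gamma> ?u - \<Delta> 0))"
    by (simp flip: scaleR_2)
  ultimately have "2 * norm (\<Gamma> ?u) \<le> norm (\<Gamma> ?u - \<Delta> 0) + norm (\<Gamma> (\<lambda>t. - ?u t) - \<Delta> 0)"
    by (metis norm_triangle_ineq4)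
  then have "norm (\<Gamma> ?u) \<le> max (norm (\<Gamma> ?u - \<Delta> 0)) (norm (\<Gamma> (\<lambda>t. - ?u t) - \<Delta> 0))"
    by linarith
  then have "ereal (norm (\<Gamma> ?u))
      \<le> max (ereal (norm (\<Gamma> ?u - \<Delta> 0))) (ereal (norm (\<Gamma> (\<lambda>t. - ?u t) - \<Delta> 0)))"
    by (simp add: le_max_iff_disj)
  also have "\<dots> \<le> gwce \<Gamma> \<alpha> x \<epsilon> \<Delta>"
    using err[OF u] err[OF nu] site by simp
  finally show ?thesis .
qed

lemma gwce_delta_glo_le:
  fixes x :: "'m::finite \<Rightarrow> 'a::metric_space"
    and \<Gamma> :: "('a \<Rightarrow> real) \<Rightarrow> 'z::banach_lattice"
  assumes "bounded (UNIV :: 'a set)" "0 \<le> \<alpha>" "\<alpha> \<le> 1"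
    and \<Gamma>: "linear_on_bounded \<Gamma>" "mono_on bounded_functions \<Gamma>"
    and V: "voronoi_partition \<alpha> x \<epsilon> V"
  shows "gwce \<Gamma> \<alpha> x \<epsilon> (\<Gamma> \<circ> delta_glo V) \<le> ereal (norm (\<Gamma> (u_zero \<alpha> x \<epsilon>)))"
  unfolding gwce_def
proof (rule Sup_least, clarsimp)
  fix f :: "'a \<Rightarrow> real" and y e :: "real^'m"
  assume f: "f \<in> holder_class \<alpha>" and y: "\<forall>m. y $ m = f (x m) + e $ m \<and> \<bar>e $ m\<bar> \<le> \<epsilon> $ m"
  have fb: "f \<in> bounded_functions" using assms f by (intro holder_class_bounded)
  have ub: "u_zero \<alpha> x \<epsilon> \<in> bounded_functions"
    by (rule holder_class_bounded[OF assms(1,2) u_zero_holder[OF assms(2,3)]])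
  have hb: "(\<lambda>t. f t - delta_glo V y t) \<in> bounded_functions"
    using bounded_functions_add[OF fb bounded_functions_scale[OF delta_glo_bounded, of "-1"]]
    by simp
  \<comment> \<open>For \<open>t\<close> in \<open>V m\<close>, the error splits into the variation
    of \<open>f\<close> between \<open>t\<close> and the site \<open>x m\<close> and the noise
    there; the two bounds add up to the term that equals \<open>u_zero\<close> on the cell.\<close>
  have "\<bar>f t - delta_glo V y t\<bar> \<le> u_zero \<alpha> x \<epsilon> t" for t
  proof -
    obtain m where m: "t \<in> V m" using V unfolding voronoi_partition_def by blast
    have "delta_glo V y t = f (x m) + e $ m"
      using V m y by (simp add: voronoi_partition_def delta_glo_eq)
    moreover have "u_zero \<alpha> x \<epsilon> t = \<epsilon> $ m + dist t (x m) powr \<alpha>"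
      using V m unfolding voronoi_partition_def by (intro u_zero_on_cell) blast
    moreover have "\<bar>f t - f (x m)\<bar> \<le> dist t (x m) powr \<alpha>"
      using f unfolding holder_class_def by blast
    moreover have "\<bar>e $ m\<bar> \<le> \<epsilon> $ m" using y by blast
    ultimately show ?thesis by linarith
  qed
  from norm_linear_mono_le[OF \<Gamma> hb ub this]
  show "norm (\<Gamma> f - \<Gamma> (delta_glo V y)) \<le> norm (\<Gamma> (u_zero \<alpha> x \<epsilon>))"
    by (simp add: linear_on_bounded_diff[OF \<Gamma>(1) fb delta_glo_bounded])
qed

theorem theorem3:
  fixes \<alpha> :: real
    and x :: "'m::finite \<Rightarrow> 'a::metric_space"
    and \<epsilon> :: "real^'m"
    and \<Gamma> :: "('a \<Rightarrow> real) \<Rightarrow> 'z::banach_lattice"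
  assumes "compact (UNIV :: 'a set)"
    and "0 < \<alpha>" and "\<alpha> \<le> 1"
    and "\<And>m. 0 \<le> \<epsilon> $ m"
    and "linear_on_bounded \<Gamma>"
    and "mono_on bounded_functions \<Gamma>"
  shows "(INF \<Delta>. gwce \<Gamma> \<alpha> x \<epsilon> \<Delta>) = ereal (norm (\<Gamma> (u_zero \<alpha> x \<epsilon>))) \<and>
    (\<forall>V. voronoi_partition \<alpha> x \<epsilon> V \<longrightarrow>
       gwce \<Gamma> \<alpha> x \<epsilon> (\<Gamma> \<circ> delta_glo V) = (INF \<Delta>. gwce \<Gamma> \<alpha> x \<epsilon> \<Delta>))"
proof -
  let ?r = "ereal (norm (\<Gamma> (u_zero \<alpha> x \<epsilon>)))"
  have bdd: "bounded (UNIV :: 'a set)" using assms(1) by (rule compact_imp_bounded)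
  have lower: "?r \<le> gwce \<Gamma> \<alpha> x \<epsilon> \<Delta>" for \<Delta>
    using assms by (intro gwce_ge bdd) auto
  have opt: "gwce \<Gamma> \<alpha> x \<epsilon> (\<Gamma> \<circ> delta_glo V) = ?r" if "voronoi_partition \<alpha> x \<epsilon> V" for V
    using assms that by (intro antisym lower gwce_delta_glo_le bdd) auto
  \<comment> \<open>Existence of a partition provides a map whose error equals the lower bound,
    which pins down the infimum.\<close>
  obtain V where "voronoi_partition \<alpha> x \<epsilon> V"
    using voronoi_partition_exists by blast
  from opt[OF this] have "(INF \<Delta>. gwce \<Gamma> \<alpha> x \<epsilon> \<Delta>) = ?r"
    by (intro antisym INF_greatest lower) (metis INF_lower UNIV_I)
  with opt show ?thesis by simp
qed

end
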